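(* Let $p$ be an odd prime and let $B$ be a non-empty subset of $\mathbb Z_p$. (i) If $p\equiv 1\pmod 4$ and $0\notin B$, then $D_{Q_p,B}=4$ or $D_{Q_p,B}=5$. (ii) If $p\equiv 3\pmod 4$ and $B\subseteq Q_p$, then $D_{Q_p,B}=5$.
   Context: For an odd prime $p$, $\mathbb Z_p=\mathbb Z/p\mathbb Z$, $U(p)$ is its group of units, and $Q_p=\{x^2:x\in U(p)\}$. A sequence of length $k$ in $\mathbb Z_p$ is an element of $\mathbb Z_p^k$. For a non-empty $B\subseteq\mathbb Z_p$, a sequence $(x_1,\ldots,x_k)$ in $\mathbb Z_p$ is called a $(Q_p,B)$-weighted zero-sum sequence if there exist $a_1,\ldots,a_k\in Q_p$ and $b_1,\ldots,b_k\in B$ such that $a_1x_1+\cdots+a_kx_k=0$ and $b_1a_1+\cdots+b_ka_k=0$ in $\mathbb Z_p$. The constant $D_{Q_p,B}$ is the least positive integer $k$ such that every sequence in $\mathbb Z_p$ of length $k$ has a (non-empty) $(Q_p,B)$-weighted zero-sum subsequence (terms not necessarily consecutive). *)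

theory Defs
  imports "HOL-Number_Theory.Number_Theory" "HOL-Library.Sublist"
begin

text \<open>Elements of \<open>\<int>/p\<int>\<close> are represented by their residues in \<open>{0..p-1}\<close>.\<close>

abbreviation Zmod :: "nat \<Rightarrow> int ring" where
  "Zmod p \<equiv> residue_ring (int p)"

definition Qset :: "nat \<Rightarrow> int set" where
  "Qset p = {x [^]\<^bsub>Zmod p\<^esub> (2::nat) | x. x \<in> Units (Zmod p)}"

definition weighted_zero_sum :: "nat \<Rightarrow> int set \<Rightarrow> int list \<Rightarrow> bool" where
  "weighted_zero_sum p B xs \<longleftrightarrow>
     (\<exists>a b :: nat \<Rightarrow> int.
        (\<forall>i<length xs. a i \<in> Qset p \<and> b i \<in> B) \<and>
        [(\<Sum>i<length xs. a i * xs ! i) = 0] (mod int p) \<and>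
        [(\<Sum>i<length xs. b i * a i) = 0] (mod int p))"

text \<open>The infimum is that of a set of natural numbers, hence a minimum whenever the set is
  non-empty. For the empty set it is 0, so a positive value of the constant includes the claim
  that it exists.\<close>

definition D_const :: "nat \<Rightarrow> int set \<Rightarrow> nat" where
  "D_const p B = Inf {k. k > 0 \<and>
     (\<forall>xs. length xs = k \<and> set xs \<subseteq> carrier (Zmod p) \<longrightarrow>
        (\<exists>ys. subseq ys xs \<and> ys \<noteq> [] \<and> weighted_zero_sum p B ys))}"

end

theory Submission
  imports Defs
begin

text \<open>
  Upper bound: fix \<open>b \<in> B\<close>. Being zero or in \<open>Q\<^sub>p\<close> means being a square, so by Chevalley's theorem
  the two quadratic forms \<open>\<Sum> x\<^sub>i y\<^sub>i\<^sup>2\<close> and \<open>\<Sum> y\<^sub>i\<^sup>2\<close> in five variables have a common nontrivial zero;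
  the terms \<open>x\<^sub>i\<close> with \<open>y\<^sub>i \<noteq> 0\<close>, with \<open>a\<^sub>i = y\<^sub>i\<^sup>2\<close> and all \<open>b\<^sub>i = b\<close>, form the required subsequence.

  Lower bounds: let \<open>r\<close> be a nonresidue. In \<open>(0, 1, -r)\<close> neither of \<open>1\<close>, \<open>-r\<close> can take part in a
  zero sum; only \<open>(0)\<close> is left, and there \<open>b a \<noteq> 0\<close>. If \<open>p \<equiv> 3 (mod 4)\<close>, two elements of \<open>Q\<^sub>p\<close> never sum to
  zero, so in \<open>(0, 0, 1, 1)\<close> the ones are excluded by the first equation and, as all \<open>b a \<in> Q\<^sub>p\<close>,
  the zeros by the second.
\<close>

section \<open>Power sums over the residues modulo \<open>p\<close>\<close>

lemma fermat_int:
  fixes a :: int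
  assumes "prime p" "\<not> int p dvd a"
  shows "[a ^ (p - 1) = 1] (mod int p)"
proof -
  have p0: "p > 0" using assms(1) prime_gt_0_nat by blast
  define b where "b = nat (a mod int p)"
  have b: "int b = a mod int p" using p0 by (simp add: b_def)
  have "\<not> p dvd b"
    using assms(2) b by (metis dvd_mod_iff dvd_refl int_dvd_int_iff)
  hence "[b ^ (p - 1) = 1] (mod p)" using fermat_theorem assms(1) by blast
  hence "[int b ^ (p - 1) = 1] (mod int p)"
    by (metis cong_int_iff of_nat_1 of_nat_power)
  moreover have "[int b ^ (p - 1) = a ^ (p - 1)] (mod int p)"
    by (simp add: b cong_pow)
  ultimately show ?thesis by (metis cong_sym cong_trans)
qed

text \<open>Multiplication by a primitive root \<open>g\<close> permutes the residues, so the sum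
  equals \<open>g ^ e\<close> times itself modulo \<open>p\<close>. For \<open>0 < e < p - 1\<close>
  the factor \<open>g ^ e - 1\<close> is not divisible by \<open>p\<close>, so the sum is.\<close>

lemma power_sum_residues_cong_0:
  assumes p: "prime p" and e: "e < p - 1"
  shows "[(\<Sum>y\<in>{0..<int p}. y ^ e) = 0] (mod int p)"
proof (cases "e = 0")
  case True
  \<comment> \<open>With \<open>0 ^ 0 = 1\<close> the sum has \<open>p\<close> terms equal to
    1.\<close>
  thus ?thesis by (simp add: cong_0_iff)
next
  case False
  have "p > 0" using p prime_gt_0_nat by blast
  have "\<exists>g. residue_primroot p g"
    using prime_primitive_root_exists[OF _ p] prime_gt_1_nat[OF p] by auto
  then obtain g where g: "coprime p g" "ord p g = p - 1"
    using p by (auto simp: residue_primroot_def totient_prime)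
  have "\<not> [g ^ e = 1] (mod p)"
    using False e g(2) by (metis ord_divides dvd_imp_le leD neq0_conv)
  hence ne: "\<not> [int g ^ e = 1] (mod int p)"
    by (metis cong_int_iff of_nat_1 of_nat_power)
  have cop: "coprime (int g) (int p)" using g(1) by (simp add: coprime_commute)
  let ?S = "{0..<int p}" and ?h = "\<lambda>y. (int g * y) mod int p"
  have "inj_on ?h ?S"
  proof (rule inj_onI)
    fix x y assume xy: "x \<in> ?S" "y \<in> ?S" "?h x = ?h y"
    hence "[x = y] (mod int p)"
      using cong_mult_lcancel[OF cop] by (simp add: cong_def)
    thus "x = y" using xy by (auto intro: cong_less_imp_eq_int)
  qed
  moreover have "?h ` ?S \<subseteq> ?S" using \<open>p > 0\<close> by auto
  ultimately have "bij_betw ?h ?S ?S"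
    by (metis bij_betw_def endo_inj_surj finite_atLeastLessThan_int)
  hence "(\<Sum>y\<in>?S. y ^ e) = (\<Sum>y\<in>?S. (?h y) ^ e)"
    using sum.reindex_bij_betw[of ?h ?S ?S "\<lambda>y. y ^ e"] by simp
  also have "[\<dots> = (\<Sum>y\<in>?S. (int g * y) ^ e)] (mod int p)"
    by (intro cong_sum cong_pow) simp
  also have "(\<Sum>y\<in>?S. (int g * y) ^ e) = int g ^ e * (\<Sum>y\<in>?S. y ^ e)"
    by (simp add: power_mult_distrib sum_distrib_left)
  finally have "int p dvd (int g ^ e - 1) * (\<Sum>y\<in>?S. y ^ e)"
    by (simp add: cong_iff_dvd_diff algebra_simps dvd_diff_commute)
  moreover have "\<not> int p dvd int g ^ e - 1" using ne by (simp add: cong_iff_dvd_diff)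
  ultimately show ?thesis
    using p by (simp add: prime_dvd_mult_iff cong_0_iff)
qed

section \<open>Polynomial functions and the Chevalley-Warning theorem\<close>

text \<open>Integer polynomials in \<open>n\<close> variables enter only through the functions they
  induce, so \<open>d\<close> is an upper bound for the degree. The slack in \<open>monomial\<close>
  lets both summands in \<open>add\<close> share one bound.\<close>

inductive poly_fun :: "nat \<Rightarrow> nat \<Rightarrow> ((nat \<Rightarrow> int) \<Rightarrow> int) \<Rightarrow> bool" for n where
  monomial: "(\<Sum>i<n. e i) \<le> d \<Longrightarrow> poly_fun n d (\<lambda>y. c * (\<Prod>i<n. y i ^ e i))"
| add: "poly_fun n d f \<Longrightarrow> poly_fun n d g \<Longrightarrow> poly_fun n d (\<lambda>y. f y + g y)"

lemma poly_fun_const: "poly_fun n d (\<lambda>y. c)"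
  using poly_fun.monomial[of "\<lambda>_. 0" n d c] by simp

text \<open>Products are built by two inductions: this one runs over the first factor and serves as
  the base case of the one over the second.\<close>

lemma poly_fun_mult_monomial:
  assumes "poly_fun n d f" "(\<Sum>i<n. e i) \<le> d'"
  shows "poly_fun n (d + d') (\<lambda>y. f y * (c * (\<Prod>i<n. y i ^ e i)))"
  using assms
proof (induction rule: poly_fun.induct)
  case (monomial e' d c')
  have "poly_fun n (d + d') (\<lambda>y. (c' * c) * (\<Prod>i<n. y i ^ (e' i + e i)))"
    using monomial by (intro poly_fun.monomial) (simp add: sum.distrib)
  thus ?case by (simp add: power_add prod.distrib mult_ac)
next
  case (add d f g)
  thus ?case using poly_fun.add by (simp add: distrib_right)
qed

lemma poly_fun_mult:
  assumes "poly_fun n d f" "poly_fun n d' g"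
  shows "poly_fun n (d + d') (\<lambda>y. f y * g y)"
  using assms(2,1)
proof (induction rule: poly_fun.induct)
  case (monomial e d' c)
  thus ?case by (intro poly_fun_mult_monomial)
next
  case (add d' g h)
  thus ?case using poly_fun.add by (simp add: distrib_left)
qed

lemma poly_fun_power: "poly_fun n d f \<Longrightarrow> poly_fun n (k * d) (\<lambda>y. f y ^ k)"
  by (induction k) (simp_all add: poly_fun_const poly_fun_mult)

lemma poly_fun_prod:
  assumes "finite J" "\<And>j. j \<in> J \<Longrightarrow> poly_fun n (d j) (f j)"
  shows "poly_fun n (\<Sum>j\<in>J. d j) (\<lambda>y. \<Prod>j\<in>J. f j y)"
  using assms by (induction rule: finite_induct) (simp_all add: poly_fun_const poly_fun_mult)

lemma poly_fun_sum:
  assumes "finite J" "\<And>j. j \<in> J \<Longrightarrow> poly_fun n d (f j)"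
  shows "poly_fun n d (\<lambda>y. \<Sum>j\<in>J. f j y)"
  using assms by (induction rule: finite_induct) (simp_all add: poly_fun_const poly_fun.add)

lemma poly_fun_scaled_square:
  assumes "i < n"
  shows "poly_fun n 2 (\<lambda>y. c * (y i)\<^sup>2)"
proof -
  have "poly_fun n 2 (\<lambda>y. c * (\<Prod>j<n. y j ^ (if j = i then 2 else 0)))"
    using assms by (intro poly_fun.monomial) simp
  moreover have "(\<Prod>j<n. y j ^ (if j = i then 2 else 0)) = (y i)\<^sup>2" for y :: "nat \<Rightarrow> int"
    using assms by (simp add: if_distrib[of "\<lambda>k. _ ^ k"] prod.delta cong: if_cong)
  ultimately show ?thesis by simp
qed

text \<open>By linearity a monomial suffices. Its sum over all points factors into \<open>n\<close>
  power sums, and since its degree is below \<open>n * (p - 1)\<close>, some exponent is below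
  \<open>p - 1\<close>; that factor vanishes modulo \<open>p\<close>.\<close>

lemma sum_poly_fun_cong_0:
  assumes "poly_fun n d f" and p: "prime p" and "d < n * (p - 1)"
  shows "[(\<Sum>y\<in>{..<n} \<rightarrow>\<^sub>E {0..<int p}. f y) = 0] (mod int p)"
  using assms(1,3)
proof (induction rule: poly_fun.induct)
  case (monomial e d c)
  have "\<exists>i<n. e i < p - 1"
  proof (rule ccontr)
    assume "\<not> ?thesis"
    hence "(\<Sum>i<n. p - 1) \<le> (\<Sum>i<n. e i)" by (intro sum_mono) (meson lessThan_iff not_less)
    thus False using monomial by simp
  qed
  then obtain i where i: "i < n" "e i < p - 1" by blast
  have "(\<Sum>y\<in>{..<n} \<rightarrow>\<^sub>E {0..<int p}. \<Prod>i<n. y i ^ e i) = (\<Prod>i<n. \<Sum>y\<in>{0..<int p}. y ^ e i)"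
    using prod_sum_PiE[of "{..<n}" "\<lambda>_. {0..<int p}" "\<lambda>i y. y ^ e i"] by simp
  moreover have "int p dvd (\<Prod>i<n. \<Sum>y\<in>{0..<int p}. y ^ e i)"
    using power_sum_residues_cong_0[OF p i(2)] i(1)
    by (intro dvd_prodI[THEN dvd_trans[rotated]]) (auto simp: cong_0_iff)
  ultimately show ?case
    by (simp add: cong_0_iff flip: sum_distrib_left)
next
  case (add d f g)
  thus ?case by (simp add: sum.distrib cong_0_iff)
qed

text \<open>Modulo \<open>p\<close> the number of common zeros is the sum over all points of a
  polynomial of degree at most \<open>p - 1\<close> times the sum of the \<open>d j\<close>. This is
  below \<open>n * (p - 1)\<close>, so the sum vanishes.\<close>

theorem chevalley_warning:
  assumes p: "prime p" and J: "finite J"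
    and f: "\<And>j. j \<in> J \<Longrightarrow> poly_fun n (d j) (f j)" and d: "(\<Sum>j\<in>J. d j) < n"
  shows "p dvd card {y \<in> {..<n} \<rightarrow>\<^sub>E {0..<int p}. \<forall>j\<in>J. [f j y = 0] (mod int p)}"
    (is "p dvd card {y \<in> ?Y. ?Z y}")
proof -
  have p1: "p > 1" using p prime_gt_1_nat by blast
  have fin: "finite ?Y" by (intro finite_PiE) auto
  \<comment> \<open>By Fermat, \<open>F\<close> is congruent to the indicator of the common zero set.\<close>
  define F where "F = (\<lambda>y. \<Prod>j\<in>J. 1 + (- 1) * f j y ^ (p - 1))"
  have "poly_fun n (\<Sum>j\<in>J. (p - 1) * d j) F"
    \<comment> \<open>The factor \<open>- 1\<close> counts as a constant of degree 0, so the closure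
      rules for sums and products cover the difference.\<close>
    unfolding F_def using poly_fun_mult[OF poly_fun_const[where d = 0] poly_fun_power[OF f]]
    by (intro poly_fun_prod J poly_fun.add poly_fun_const) (simp only: add_0)
  moreover have "(\<Sum>j\<in>J. (p - 1) * d j) < n * (p - 1)"
    using d p1 by (simp flip: sum_distrib_left)
  ultimately have sum_0: "[(\<Sum>y\<in>?Y. F y) = 0] (mod int p)"
    using sum_poly_fun_cong_0 p by blast
  have "[F y = (if ?Z y then 1 else 0)] (mod int p)" for y
  proof (cases "?Z y")
    case True
    have "[F y = (\<Prod>j\<in>J. 1 + (- 1) * 0 ^ (p - 1))] (mod int p)"
      unfolding F_def using True by (intro cong_prod cong_add cong_mult cong_pow) auto
    \<comment> \<open>Since \<open>p > 1\<close>, the exponent is positive and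
      \<open>0 ^ (p - 1)\<close> is 0.\<close>
    thus ?thesis using True p1 by (simp add: power_0_left)
  next
    case False
    then obtain j where j: "j \<in> J" "\<not> int p dvd f j y" by (auto simp: cong_0_iff)
    have "[f j y ^ (p - 1) = 1] (mod int p)" using fermat_int p j(2) by blast
    hence "int p dvd 1 + (- 1) * f j y ^ (p - 1)"
      by (simp add: cong_iff_dvd_diff dvd_diff_commute)
    hence "int p dvd F y" unfolding F_def by (rule dvd_trans[OF _ dvd_prodI[OF J j(1)]])
    thus ?thesis unfolding if_not_P[OF False] by (simp add: cong_0_iff)
  qed
  hence sum_card: "[(\<Sum>y\<in>?Y. F y) = (\<Sum>y\<in>?Y. if ?Z y then 1 else 0)] (mod int p)"
    by (intro cong_sum)
  have card: "(\<Sum>y\<in>?Y. if ?Z y then 1 else 0) = int (card {y \<in> ?Y. ?Z y})"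
    using fin by (simp add: sum.If_cases Int_def)
  have "[int (card {y \<in> ?Y. ?Z y}) = 0] (mod int p)"
    using cong_trans[OF cong_sym[OF sum_card] sum_0] unfolding card .
  thus ?thesis by (simp add: cong_0_iff)
qed

text \<open>The origin is a common zero, and \<open>p\<close> divides the number of them, so it
  cannot be the only one.\<close>

corollary chevalley:
  assumes p: "prime p" and J: "finite J"
    and f: "\<And>j. j \<in> J \<Longrightarrow> poly_fun n (d j) (f j)" and d: "(\<Sum>j\<in>J. d j) < n"
    and zero: "\<And>j. j \<in> J \<Longrightarrow> [f j (\<lambda>i\<in>{..<n}. 0) = 0] (mod int p)"
  obtains y where "\<And>j. j \<in> J \<Longrightarrow> [f j y = 0] (mod int p)"
    and "\<exists>i<n. \<not> int p dvd y i"
proof -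
  let ?Z = "{y \<in> {..<n} \<rightarrow>\<^sub>E {0..<int p}. \<forall>j\<in>J. [f j y = 0] (mod int p)}"
  let ?o = "\<lambda>i\<in>{..<n}. 0 :: int"
  have p1: "p > 1" using p prime_gt_1_nat by blast
  have "?o \<in> ?Z" using zero p1 by auto
  have "?Z \<noteq> {?o}"
    using chevalley_warning[OF p J f d] p1 by auto
  then obtain y where y: "y \<in> ?Z" "y \<noteq> ?o" using \<open>?o \<in> ?Z\<close> by blast
  have "\<exists>i<n. y i \<noteq> 0"
  proof (rule ccontr)
    assume "\<not> ?thesis"
    hence "y = ?o" using y(1) by (intro PiE_ext[of y "{..<n}" "\<lambda>_. {0..<int p}"]) (use p1 in auto)
    thus False using y(2) by blast
  qed
  then obtain i where i: "i < n" "y i \<noteq> 0" by blast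
  moreover have "0 \<le> y i" "y i < int p" using y(1) i(1) by (auto simp: PiE_iff)
  ultimately have "\<not> int p dvd y i" using zdvd_imp_le by fastforce
  thus ?thesis using that y(1) i(1) by auto
qed

section \<open>Squares of units modulo \<open>p\<close>\<close>

text \<open>Replaces the residue ring by integer arithmetic; the root \<open>x\<close> need not be
  reduced.\<close>

lemma Qset_iff:
  assumes p: "prime p"
  shows "a \<in> Qset p \<longleftrightarrow> (\<exists>x. \<not> int p dvd x \<and> a = x\<^sup>2 mod int p)"
proof -
  interpret residues_prime p "Zmod p" by unfold_locales (use p in auto)
  have p1: "p > 1" using p prime_gt_1_nat by blast
  have pow: "x [^]\<^bsub>Zmod p\<^esub> (2::nat) = x\<^sup>2 mod int p" if "x \<in> {1..int p - 1}" for x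
    using pow_cong[of x 2] that by simp
  show ?thesis
  proof
    assume "a \<in> Qset p"
    then obtain x where "x \<in> {1..int p - 1}" "a = x\<^sup>2 mod int p"
      using pow p1 by (auto simp: Qset_def res_prime_units_eq of_nat_diff)
    moreover from this(1) have "\<not> int p dvd x" by (intro zdvd_not_zless) auto
    ultimately show "\<exists>x. \<not> int p dvd x \<and> a = x\<^sup>2 mod int p" by blast
  next
    assume "\<exists>x. \<not> int p dvd x \<and> a = x\<^sup>2 mod int p"
    then obtain x where x: "\<not> int p dvd x" "a = x\<^sup>2 mod int p" by blast
    have "x mod int p \<noteq> 0" using x(1) by (simp add: dvd_eq_mod_eq_0)
    moreover have "0 \<le> x mod int p" "x mod int p < int p" using p1 by auto
    ultimately have m: "x mod int p \<in> {1..int p - 1}" by auto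
    have "a = (x mod int p)\<^sup>2 mod int p" using x(2) by (simp add: power_mod)
    thus "a \<in> Qset p"
      using m pow[OF m] p1 by (auto simp: Qset_def res_prime_units_eq of_nat_diff intro!: exI[of _ "x mod int p"])
  qed
qed

lemma Qset_not_dvd: "prime p \<Longrightarrow> a \<in> Qset p \<Longrightarrow> \<not> int p dvd a"
  by (auto simp: Qset_iff dvd_mod_iff prime_dvd_power_iff)

lemma Qset_mult:
  assumes p: "prime p" and "a \<in> Qset p" "b \<in> Qset p"
  shows "(a * b) mod int p \<in> Qset p"
proof -
  obtain x y where xy: "\<not> int p dvd x" "a = x\<^sup>2 mod int p" "\<not> int p dvd y" "b = y\<^sup>2 mod int p"
    using assms by (auto simp: Qset_iff)
  have "\<not> int p dvd x * y" using p xy by (simp add: prime_dvd_mult_iff)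
  moreover have "(a * b) mod int p = (x * y)\<^sup>2 mod int p"
    by (simp add: xy mod_mult_eq power_mult_distrib)
  ultimately show ?thesis using p by (auto simp: Qset_iff)
qed

text \<open>If \<open>a\<close> is the square of \<open>x\<close> and \<open>z\<close> inverts
  \<open>x\<close>, then \<open>r\<close> is congruent to the square of \<open>z\<close> times
  \<open>b\<close>, a product of two elements of \<open>Qset p\<close>.\<close>

lemma Qset_quotient:
  assumes p: "prime p" and "a \<in> Qset p" "b \<in> Qset p" and ab: "[a * r = b] (mod int p)"
  shows "r mod int p \<in> Qset p"
proof -
  obtain x where x: "\<not> int p dvd x" "a = x\<^sup>2 mod int p" using assms by (auto simp: Qset_iff)
  have "coprime x (int p)" using p x(1) prime_imp_coprime coprime_commute
    by (metis prime_nat_int_transfer)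
  then obtain z where z: "[x * z = 1] (mod int p)" using cong_solve_coprime_int by blast
  have "\<not> int p dvd z"
  proof
    assume "int p dvd z"
    hence "[x * z = 0] (mod int p)" by (simp add: cong_0_iff)
    hence "[1 = (0::int)] (mod int p)" using z by (metis cong_sym cong_trans)
    thus False using p by (auto simp: cong_0_iff)
  qed
  hence zQ: "z\<^sup>2 mod int p \<in> Qset p" using p by (auto simp: Qset_iff)
  have "[(z\<^sup>2 mod int p) * b = z\<^sup>2 * (x\<^sup>2 * r)] (mod int p)"
    using ab x(2) by (intro cong_mult) (auto simp: cong_def mod_mult_left_eq)
  also have "z\<^sup>2 * (x\<^sup>2 * r) = (x * z)\<^sup>2 * r" by (simp add: power_mult_distrib)
  also have "[\<dots> = 1\<^sup>2 * r] (mod int p)" using z by (intro cong_mult cong_pow) auto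
  finally have "(z\<^sup>2 mod int p * b) mod int p = r mod int p" by (simp add: cong_def)
  thus ?thesis using Qset_mult[OF p zQ assms(3)] by simp
qed

text \<open>The distinct units \<open>1\<close> and \<open>p - 1\<close> have the same square, so
  squaring is not injective on the finite set of units and misses one of them.\<close>

lemma exists_nonresidue:
  assumes p: "prime p" "odd p"
  obtains r where "0 < r" "r < int p" "r \<notin> Qset p"
proof -
  let ?U = "{1..int p - 1}" and ?s = "\<lambda>x. x\<^sup>2 mod int p"
  have p3: "p \<ge> 3" using p prime_ge_2_nat[of p] by (cases "p = 2") auto
  have "?s (int p - 1) = ?s 1"
    using p3 by (intro cong_def[THEN iffD1]) (simp add: cong_iff_dvd_diff power2_eq_square algebra_simps)
  moreover have "int p - 1 \<noteq> 1" using p3 by simp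
  moreover have "int p - 1 \<in> ?U" "1 \<in> ?U" using p3 by auto
  ultimately have "\<not> inj_on ?s ?U" by (meson inj_onD)
  hence "card (?s ` ?U) < card ?U"
    by (metis card_image_le eq_card_imp_inj_on finite_atLeastAtMost_int le_neq_implies_less)
  hence "\<not> ?U \<subseteq> ?s ` ?U" by (meson card_mono finite_atLeastAtMost_int finite_imageI not_less)
  then obtain r where r: "r \<in> ?U" "r \<notin> ?s ` ?U" by blast
  have "Qset p \<subseteq> ?s ` ?U"
  proof
    fix a assume "a \<in> Qset p"
    then obtain x where x: "\<not> int p dvd x" "a = x\<^sup>2 mod int p" using p by (auto simp: Qset_iff)
    have "x mod int p \<noteq> 0" using x(1) by (simp add: dvd_eq_mod_eq_0)
    moreover have "0 \<le> x mod int p" "x mod int p < int p" using p3 by auto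
    ultimately have "x mod int p \<in> ?U" by auto
    moreover have "a = ?s (x mod int p)" using x(2) by (simp add: power_mod)
    ultimately show "a \<in> ?s ` ?U" by blast
  qed
  thus ?thesis using r that[of r] by auto
qed

text \<open>This says that \<open>- 1\<close> is a nonresidue: if two squares were opposite, raising
  them to the odd power \<open>(p - 1) / 2\<close> would give \<open>1 = - 1\<close> modulo
  \<open>p\<close> by Fermat.\<close>

lemma Qset_sum_not_dvd:
  assumes p: "prime p" "[p = 3] (mod 4)" and "a \<in> Qset p" "b \<in> Qset p"
  shows "\<not> int p dvd a + b"
proof
  assume dvd: "int p dvd a + b"
  obtain x y where xy: "\<not> int p dvd x" "a = x\<^sup>2 mod int p" "\<not> int p dvd y" "b = y\<^sup>2 mod int p"
    using assms by (auto simp: Qset_iff)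
  have "p mod 4 = 3" using p(2) by (simp add: cong_def)
  define k where "k = p div 4"
  have k: "p = 4 * k + 3" using \<open>p mod 4 = 3\<close> unfolding k_def by presburger
  hence pm: "p - 1 = 2 * (2 * k + 1)" by simp
  have odd: "odd (2 * k + 1)" by simp
  have "int p dvd x\<^sup>2 + y\<^sup>2"
    using dvd by (simp add: xy dvd_eq_mod_eq_0 mod_add_eq)
  hence "[x\<^sup>2 = - (y\<^sup>2)] (mod int p)" by (simp add: cong_iff_dvd_diff)
  hence "[(x\<^sup>2) ^ (2 * k + 1) = (- (y\<^sup>2)) ^ (2 * k + 1)] (mod int p)" by (rule cong_pow)
  hence "[x ^ (p - 1) = - (y ^ (p - 1))] (mod int p)"
    unfolding pm power_mult by (simp only: power_minus_odd[OF odd])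
  moreover have "[x ^ (p - 1) = 1] (mod int p)" "[y ^ (p - 1) = 1] (mod int p)"
    using fermat_int p xy by auto
  ultimately have "[1 = (- 1 :: int)] (mod int p)"
    by (metis cong_minus_minus_iff cong_sym cong_trans)
  hence "int p dvd 2" by (simp add: cong_iff_dvd_diff)
  hence "int p \<le> 2" by (rule zdvd_imp_le) simp
  thus False using k by simp
qed

section \<open>The constant and its upper bound\<close>

text \<open>One admissible length makes the infimum a minimum, so \<open>D_const p B\<close> is
  itself admissible.\<close>

lemma D_const_attained:
  assumes "k > 0" and "\<And>xs. length xs = k \<Longrightarrow> set xs \<subseteq> carrier (Zmod p) \<Longrightarrow>
      \<exists>ys. subseq ys xs \<and> ys \<noteq> [] \<and> weighted_zero_sum p B ys"
  shows "D_const p B \<le> k"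
    and "\<And>xs. length xs = D_const p B \<Longrightarrow> set xs \<subseteq> carrier (Zmod p) \<Longrightarrow>
      \<exists>ys. subseq ys xs \<and> ys \<noteq> [] \<and> weighted_zero_sum p B ys"
proof -
  let ?K = "{k. k > 0 \<and> (\<forall>xs. length xs = k \<and> set xs \<subseteq> carrier (Zmod p) \<longrightarrow>
      (\<exists>ys. subseq ys xs \<and> ys \<noteq> [] \<and> weighted_zero_sum p B ys))}"
  have k: "k \<in> ?K" using assms by blast
  thus "D_const p B \<le> k" unfolding D_const_def by (rule cInf_lower) simp
  have "D_const p B \<in> ?K" unfolding D_const_def using k by (intro Inf_nat_def1) blast
  thus "\<And>xs. length xs = D_const p B \<Longrightarrow> set xs \<subseteq> carrier (Zmod p) \<Longrightarrow>
      \<exists>ys. subseq ys xs \<and> ys \<noteq> [] \<and> weighted_zero_sum p B ys" by blast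
qed

text \<open>Terms whose coefficient vanishes modulo \<open>p\<close> are dropped without changing
  either sum modulo \<open>p\<close>; a constant weight \<open>b\<close> only scales the second
  one.\<close>

lemma weighted_zero_sum_subseq_exists:
  assumes b: "b \<in> B"
    and a: "\<And>i. i < length xs \<Longrightarrow> int p dvd a i \<or> a i \<in> Qset p"
    and nz: "\<exists>i<length xs. \<not> int p dvd a i"
    and ax: "[(\<Sum>i<length xs. a i * xs ! i) = 0] (mod int p)"
    and s: "[(\<Sum>i<length xs. a i) = 0] (mod int p)"
  shows "\<exists>ys. subseq ys xs \<and> ys \<noteq> [] \<and> weighted_zero_sum p B ys"
proof -
  define I where "I = {i. i < length xs \<and> \<not> int p dvd a i}"
  \<comment> \<open>The support is listed in increasing order, so that reading \<open>xs\<close>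
    along \<open>js\<close> yields a subsequence.\<close>
  define js where "js = filter (\<lambda>i. i \<in> I) [0..<length xs]"
  have js: "set js = I" "distinct js" by (auto simp: js_def I_def)
  have restrict: "(\<Sum>k<length js. h (js ! k)) = (\<Sum>i\<in>I. h i)" for h :: "nat \<Rightarrow> int"
  proof -
    have "(\<Sum>k<length js. h (js ! k)) = sum_list (map h js)"
      by (simp add: sum_list_sum_nth lessThan_atLeast0)
    also have "\<dots> = (\<Sum>i\<in>I. h i)" using js by (metis sum_list_distinct_conv_sum_set)
    finally show ?thesis .
  qed
  have drop: "[(\<Sum>i\<in>I. h i) = (\<Sum>i<length xs. h i)] (mod int p)"
    if "\<And>i. int p dvd a i \<Longrightarrow> int p dvd h i" for h
  proof -
    have "(\<Sum>i<length xs. h i) = (\<Sum>i\<in>I. h i) + (\<Sum>i\<in>{..<length xs} - I. h i)"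
      by (subst sum.subset_diff[of I]) (auto simp: I_def)
    moreover have "int p dvd (\<Sum>i\<in>{..<length xs} - I. h i)"
      using that by (intro dvd_sum) (auto simp: I_def)
    ultimately show ?thesis by (simp add: cong_iff_dvd_diff)
  qed
  have "[(\<Sum>i\<in>I. a i * xs ! i) = 0] (mod int p)" by (rule cong_trans[OF drop ax]) simp
  hence 1: "[(\<Sum>k<length js. a (js ! k) * xs ! (js ! k)) = 0] (mod int p)"
    unfolding restrict[of "\<lambda>i. a i * xs ! i"] .
  have "[(\<Sum>i\<in>I. a i) = 0] (mod int p)" by (rule cong_trans[OF drop s]) simp
  hence "[(\<Sum>i\<in>I. b * a i) = 0] (mod int p)"
    by (simp add: cong_0_iff flip: sum_distrib_left)
  hence 2: "[(\<Sum>k<length js. b * a (js ! k)) = 0] (mod int p)"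
    unfolding restrict[of "\<lambda>i. b * a i"] .
  have "js ! k \<in> I" if "k < length js" for k using that js(1) nth_mem by blast
  hence "a (js ! k) \<in> Qset p" if "k < length js" for k using that a by (auto simp: I_def)
  hence "weighted_zero_sum p B (map ((!) xs) js)"
    unfolding weighted_zero_sum_def using 1 2 b
    by (intro exI[of _ "\<lambda>k. a (js ! k)"] exI[of _ "\<lambda>_. b"]) simp
  moreover have "subseq (map ((!) xs) js) xs"
    using subseq_map[OF subseq_filter_left[of "\<lambda>i. i \<in> I" "[0..<length xs]"], of "(!) xs"]
    unfolding js_def by (simp only: map_nth)
  moreover have "I \<noteq> {}" using nz by (auto simp: I_def)
  hence "map ((!) xs) js \<noteq> []" using js(1) by auto
  ultimately show ?thesis by blast
qed

lemma weighted_zero_sum_subseq_length_5: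
  assumes p: "prime p" and b: "b \<in> B" and len: "length xs = 5"
  shows "\<exists>ys. subseq ys xs \<and> ys \<noteq> [] \<and> weighted_zero_sum p B ys"
proof -
  \<comment> \<open>\<open>f True\<close> carries the terms of \<open>xs\<close> as coefficients and
    \<open>f False\<close> is the plain sum of squares. The degrees add up to 4, below the 5
    variables.\<close>
  define f where "f j y = (\<Sum>i<5. (if j then xs ! i else 1) * (y i)\<^sup>2)" for j and y :: "nat \<Rightarrow> int"
  have "poly_fun 5 2 (f j)" for j
    unfolding f_def by (intro poly_fun_sum poly_fun_scaled_square) auto
  moreover have "[f j (\<lambda>i\<in>{..<5}. 0) = 0] (mod int p)" for j by (simp add: f_def)
  ultimately obtain y where y: "\<And>j. [f j y = 0] (mod int p)" "\<exists>i<5. \<not> int p dvd y i"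
    using chevalley[OF p, of "UNIV :: bool set" 5 "\<lambda>_. 2" f] by (simp add: UNIV_bool) blast
  \<comment> \<open>The squares are reduced because \<open>Qset p\<close> consists of reduced
    residues.\<close>
  let ?a = "\<lambda>i. (y i)\<^sup>2 mod int p"
  have dvd: "int p dvd ?a i \<longleftrightarrow> int p dvd y i" for i
    using p by (simp add: dvd_mod_iff prime_dvd_power_iff)
  have "[(\<Sum>i<5. ?a i * xs ! i) = f True y] (mod int p)"
    unfolding f_def by (intro cong_sum) (simp add: cong_def mod_mult_right_eq mult.commute)
  moreover have "[(\<Sum>i<5. ?a i) = f False y] (mod int p)"
    unfolding f_def by (intro cong_sum) simp
  ultimately have "[(\<Sum>i<5. ?a i * xs ! i) = 0] (mod int p)" "[(\<Sum>i<5. ?a i) = 0] (mod int p)"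
    using y(1) cong_trans by blast+
  thus ?thesis
    using weighted_zero_sum_subseq_exists[OF b, of xs p ?a] len dvd y(2) p
    by (auto simp: Qset_iff)
qed

lemma D_const_le_5:
  assumes "prime p" "B \<noteq> {}"
  shows "D_const p B \<le> 5"
proof -
  obtain b where "b \<in> B" using assms(2) by blast
  thus ?thesis
    using D_const_attained(1)[OF _ weighted_zero_sum_subseq_length_5[OF assms(1)]] by simp
qed

section \<open>Lower bounds from explicit sequences\<close>

text \<open>Otherwise the prefix of \<open>xs\<close> of length \<open>D_const p B\<close> would
  contain a weighted zero-sum subsequence, which is also one of \<open>xs\<close>.\<close>

lemma D_const_greater:
  assumes p: "prime p" and B: "B \<noteq> {}" and xs: "set xs \<subseteq> carrier (Zmod p)"
    and no: "\<And>ys. subseq ys xs \<Longrightarrow> ys \<noteq> [] \<Longrightarrow> \<not> weighted_zero_sum p B ys"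
  shows "length xs < D_const p B"
proof (rule ccontr)
  assume "\<not> length xs < D_const p B"
  obtain b where "b \<in> B" using B by blast
  from \<open>\<not> length xs < D_const p B\<close> have "length (take (D_const p B) xs) = D_const p B" by simp
  moreover have "set (take (D_const p B) xs) \<subseteq> carrier (Zmod p)"
    using xs set_take_subset by fast
  ultimately obtain ys where ys: "subseq ys (take (D_const p B) xs)" "ys \<noteq> []"
      "weighted_zero_sum p B ys"
    \<comment> \<open>Length 5 is admissible, which guarantees that the minimum is attained.\<close>
    using D_const_attained(2)[OF _ weighted_zero_sum_subseq_length_5[OF p \<open>b \<in> B\<close>], of 5]
    by (meson zero_less_numeral)
  have "subseq ys xs"
    using ys(1) by (metis append_take_drop_id prefix_def prefix_imp_subseq subseq_order.trans)
  thus False using no ys by blast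
qed

lemma D_const_gt_3:
  assumes p: "prime p" "odd p" and B: "B \<subseteq> carrier (Zmod p)" "B \<noteq> {}" "0 \<notin> B"
  shows "3 < D_const p B"
proof -
  interpret residues_prime p "Zmod p" by unfold_locales (use p in auto)
  obtain r where r: "0 < r" "r < int p" "r \<notin> Qset p" using exists_nonresidue p by blast
  \<comment> \<open>The reduced representative of \<open>- r\<close>.\<close>
  define s where "s = int p - r"
  have carrier: "carrier (Zmod p) = {0..int p - 1}" by (simp add: res_carrier_eq)
  have Bd: "\<not> int p dvd b" if "b \<in> B" for b
    using that B by (auto simp: carrier dest!: zdvd_imp_le)
  have rd: "\<not> int p dvd s" using r by (auto simp: s_def dest!: zdvd_imp_le)
  \<comment> \<open>Modulo \<open>p\<close> this is \<open>a - c * r\<close>; if it vanished,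
    \<open>r\<close> would be the quotient of \<open>a\<close> by \<open>c\<close> and hence a
    residue.\<close>
  have pair: "\<not> int p dvd a + c * s" if ac: "a \<in> Qset p" "c \<in> Qset p" for a c
  proof
    assume "int p dvd a + c * s"
    hence "int p dvd c * int p - (a + c * s)" by (intro dvd_diff) auto
    hence "[c * r = a] (mod int p)" by (simp add: s_def cong_iff_dvd_diff algebra_simps)
    hence "r mod int p \<in> Qset p" using Qset_quotient p ac by blast
    thus False using r by simp
  qed
  have "\<not> weighted_zero_sum p B ys" if "subseq ys [0, 1, s]" "ys \<noteq> []" for ys
  proof
    assume "weighted_zero_sum p B ys"
    then obtain a b where w: "\<forall>i<length ys. a i \<in> Qset p \<and> b i \<in> B"
        "int p dvd (\<Sum>i<length ys. a i * ys ! i)" "int p dvd (\<Sum>i<length ys. b i * a i)"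
      by (auto simp: weighted_zero_sum_def cong_0_iff)
    have "ys \<in> set (subseqs [0, 1, s])" using that(1) by (simp only: in_set_subseqs)
    hence "ys = [0] \<or> ys = [1] \<or> ys = [s] \<or> ys = [0, 1] \<or> ys = [0, s] \<or> ys = [1, s] \<or> ys = [0, 1, s]"
      using that(2) by (simp add: Let_def del: in_set_subseqs) blast
    thus False
      \<comment> \<open>\<open>[0]\<close> violates the second equation. The other lists violate the
        first: by \<open>pair\<close> if both \<open>1\<close> and \<open>s\<close> occur, otherwise
        because a single nonzero term remains.\<close>
      using w by (elim disjE) (simp_all add: Bd rd pair p prime_dvd_mult_iff Qset_not_dvd All_less_Suc)
  qed
  hence "length [0, 1, s] < D_const p B"
    using r prime_gt_1_nat[OF p(1)] p B
    by (intro D_const_greater) (auto simp: carrier s_def)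
  thus ?thesis by simp
qed

lemma D_const_gt_4:
  assumes p: "prime p" "[p = 3] (mod 4)" and B: "B \<subseteq> Qset p" "B \<noteq> {}"
  shows "4 < D_const p B"
proof -
  interpret residues_prime p "Zmod p" by unfold_locales (use p in auto)
  have carrier: "carrier (Zmod p) = {0..int p - 1}" by (simp add: res_carrier_eq)
  have Bd: "\<not> int p dvd b" if "b \<in> B" for b
    using that B p Qset_not_dvd by blast
  have pair: "\<not> int p dvd a + c" if "a \<in> Qset p" "c \<in> Qset p" for a c
    using Qset_sum_not_dvd p that by blast
  \<comment> \<open>Here \<open>B\<close> inside \<open>Qset p\<close> matters: each product of a
    weight and a coefficient is again a square, so \<open>pair\<close> applies to the reduced
    products.\<close>
  have wpair: "\<not> int p dvd b * a + b' * a'"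
    if "a \<in> Qset p" "a' \<in> Qset p" "b \<in> B" "b' \<in> B" for a a' b b'
  proof
    assume "int p dvd b * a + b' * a'"
    hence "int p dvd (b * a) mod int p + (b' * a') mod int p"
      by (simp add: dvd_eq_mod_eq_0 mod_add_eq)
    moreover have "(b * a) mod int p \<in> Qset p" "(b' * a') mod int p \<in> Qset p"
      using that B p Qset_mult by blast+
    ultimately show False using pair by blast
  qed
  have "\<not> weighted_zero_sum p B ys" if "subseq ys [0, 0, 1, 1]" "ys \<noteq> []" for ys
  proof
    assume "weighted_zero_sum p B ys"
    then obtain a b where w: "\<forall>i<length ys. a i \<in> Qset p \<and> b i \<in> B"
        "int p dvd (\<Sum>i<length ys. a i * ys ! i)" "int p dvd (\<Sum>i<length ys. b i * a i)"
      by (auto simp: weighted_zero_sum_def cong_0_iff)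
    have "ys \<in> set (subseqs [0, 0, 1, 1])" using that(1) by (simp only: in_set_subseqs)
    \<comment> \<open>Equal entries leave eight distinct nonempty subsequences. Those containing a
      \<open>1\<close> fail the first equation, the two made of zeros fail the second.\<close>
    hence "ys = [0] \<or> ys = [1] \<or> ys = [0, 0] \<or> ys = [0, 1] \<or> ys = [1, 1] \<or>
        ys = [0, 0, 1] \<or> ys = [0, 1, 1] \<or> ys = [0, 0, 1, 1]"
      using that(2) by (simp add: Let_def del: in_set_subseqs) blast
    thus False
      using w by (elim disjE) (simp_all add: Bd wpair pair p prime_dvd_mult_iff Qset_not_dvd All_less_Suc)
  qed
  hence "length [0, 0, 1, 1 :: int] < D_const p B"
    using prime_gt_1_nat[OF p(1)] p B
    by (intro D_const_greater) (auto simp: carrier)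
  thus ?thesis by simp
qed

theorem theorem5p5:
  fixes p :: nat and B :: "int set"
  assumes "prime p" and "odd p"
    and "B \<subseteq> carrier (Zmod p)" and "B \<noteq> {}"
  shows "([p = 1] (mod 4) \<and> 0 \<notin> B \<longrightarrow> D_const p B = 4 \<or> D_const p B = 5) \<and>
         ([p = 3] (mod 4) \<and> B \<subseteq> Qset p \<longrightarrow> D_const p B = 5)"
proof (intro conjI impI; elim conjE)
  assume "0 \<notin> B"
  thus "D_const p B = 4 \<or> D_const p B = 5"
    using D_const_le_5[OF assms(1,4)] D_const_gt_3[OF assms] by linarith
next
  assume "[p = 3] (mod 4)" "B \<subseteq> Qset p"
  thus "D_const p B = 5"
    using D_const_le_5[OF assms(1,4)] D_const_gt_4[of p B] assms(1,4) by simp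
qed

end
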